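(* Assume that the approximate fluxes $\{F^{\xi}_{j+\frac12}(t),\ 0\le t<k\}_{j=-\infty}^{\infty}$ ($\xi\in V^k$) are consistent of order $q$ with the balance law, and let $\Phi^k=P^k\widetilde{S(k)}$ be a Finite Volume Scheme associated with these fluxes. With $\Delta t=k$, $\Delta x=h$, define the discrete operator $\Phi_{\Delta t,\Delta x}$ by $$\big[\Phi_{\Delta t,\Delta x}\,\xi\big]_j=h^{-1}\int_{I_j}\Phi^k(\xi)(x)\,dx-h^{-1}\int_{I_j}\xi(x)\,dx,\qquad \xi\in V^k,\ j\in\mathbb{Z}.$$ Then $\Phi_{\Delta t,\Delta x}$ is consistent of order $q$ in the classical sense when acting on the averages of the exact solution: if $\theta^0=P^ku_0$ with $u_0\in\mathfrak{U}$, $\theta^{n+1}=P^k\big(u(\cdot,k;\theta^n)\big)$ and $\theta^n_j=h^{-1}\int_{I_j}\theta^n(x)\,dx$, then $$\Big|\theta^{n+1}_j-\big[\theta^n_j+(\Phi_{\Delta t,\Delta x}\theta^n)_j\big]\Big|=\mathcal{O}(k^{1+q}),\qquad -\infty<j<\infty.$$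
   Context: Setting. Fix $D\ge1$, a flux $f:\mathbb{R}^D\to\mathbb{R}^D$ and $T>0$. Let $\mathfrak{U}^b,\mathfrak{U}^c$ be Banach spaces of ($\mathbb{R}^D$-valued) functions on $\mathbb{R}$, $\mathfrak{U}=\mathfrak{U}^b\cap\mathfrak{U}^c$ with norm $\|w\|_{\mathfrak{U}}=\|w\|_b+\|w\|_c$. The balance law (for $u_t+f(u)_x=0$) is $$\int_{x_1}^{x_2}u(x,t_2)dx-\int_{x_1}^{x_2}u(x,t_1)dx=-\Big[\int_{t_1}^{t_2}f(u(x_2,t))dt-\int_{t_1}^{t_2}f(u(x_1,t))dt\Big].$$ A function $u(\cdot,t)$, continuous in $t$ with values in $\mathfrak{U}^c$ and bounded in $t$ with values in $\mathfrak{U}^b$, is a solution of the balance law if: for every $x$ and $[t_1,t_2]$, $\int_{t_1}^{t_2}f(u(x,t))dt$ is well defined and continuous in $x$; for every $t$ and $[x_1,x_2]$, $\int_{x_1}^{x_2}u(x,t)dx$ is well defined and continuous in $t$; and the balance law holds on every rectangle $[x_1,x_2]\times[t_1,t_2]$. Grid. $k=\Delta t>0$ is the time step, $h=\Delta x=\lambda^{-1}k$ with $\lambda>0$ fixed, $x_j=jh$, $x_{j\pm\frac12}=x_j\pm\frac h2$, $I_j=(x_{j-\frac12},x_{j+\frac12})$. Spaces. $V^k\subseteq\mathfrak{U}$ is a subspace whose restrictions to any grid cell $I_j$ form a finite dimensional space (its dimension is the order of $V^k$; typically piecewise polynomials of fixed degree, possibly discontinuous at cell boundaries), and $P^k:\mathfrak{U}\to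 V^k$ is a projection with $\int_{I_j}P^kv\,dx=\int_{I_j}v\,dx$ for all $j$ and $v\in\mathfrak{U}$. Short-time solutions. For each $\xi\in V^k$ the balance law is assumed to have a unique solution on $[0,k]$ with initial data $\xi$ (uniqueness possibly being achieved by imposing constraints such as entropy conditions), denoted $u(x,t;\xi)=S(t)\xi\in\mathfrak{U}$. Approximate fluxes. There is $\lambda_0>0$ such that for every fixed $\lambda=k/h<\lambda_0$, $0<k<\frac12T$, and $\xi\in V^k$ there is a sequence of continuous functions $F^\xi_{j+\frac12}(t)$, $0\le t<k$, $j\in\mathbb{Z}$. They are approximate fluxes if $F^\xi_{j+\frac12}(t)$ depends only on the restriction of $\xi$ to $I_j\cup I_{j+1}$, and $F^\xi_{j+\frac12}(t)\equiv f(c)$ whenever $\xi\equiv c$ is constant on $I_j\cup I_{j+1}$. Admissible sets. $H\subseteq\bigcup_{0<k<\frac12T}V^k$ is admissible if for every $\lambda=k/h<\lambda_0$ the set $H\cap V^k$ is bounded in $\mathfrak{U}$ and compact in $L^1_{loc}(\mathbb{R})$. Consistency. For $q\ge0$ the fluxes are consistent of order $q$ if for every admissible $H$ there is $C>0$ depending only on $H$ such that for all $\xi\in H\cap V^k$ and all $j$, $$\Big|\int_0^k\big[F^\xi_{j+\frac12}(t)-F^\xi_{j-\frac12}(t)\big]dt-\int_0^k\big[f(u(x_{j+\frac12},t;\xi))-f(u(x_{j-\frac12},t;\xi))\big]dt\Big|\le Ck^{2+q}.$$ Finite Volume Scheme (FVS). An approximate evolution operator associated with the fluxes is a map $\widetilde{S(k)}:V^k\to\mathfrak{U}$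 with $$\int_{I_j}\widetilde{S(k)}\xi\,dx-\int_{I_j}\xi\,dx=-\int_0^k\big[F^\xi_{j+\frac12}(t)-F^\xi_{j-\frac12}(t)\big]dt,\qquad \xi\in V^k,\ j\in\mathbb{Z}.$$ A family of maps $\{\Phi^k:V^k\to V^k\}_{k>0}$ is an FVS if $\Phi^k=P^k\widetilde{S(k)}$. Classical consistency. A fully discrete scheme $v^{n+1}=v^n+\Phi_{\Delta t,\Delta x}v^n$ is consistent of order $q$ on $[0,T]$ if the discrete data $u^n_{disc}$ of the exact solution satisfy $u^{n+1}_{disc}-[u^n_{disc}+\Phi_{\Delta t,\Delta x}u^n_{disc}]=O(\Delta t^{1+q})$ for $n\Delta t<T$. Convention: the bound $\mathcal{O}(k^{1+q})$ is uniform in $j$; as in the definition of consistency, its constant depends only on an admissible set $H$ containing the functions $\theta^n$. *)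

theory Defs
  imports "HOL-Analysis.Analysis"
begin

text \<open>
  The elements of the function spaces below are honest functions on the real line, since the balance
  law evaluates a solution at individual points \<open>x\<close>. Two of them represent the same element of
  a space of equivalence classes when they agree almost everywhere.
\<close>

definition ae_eq :: "(real \<Rightarrow> 'a) \<Rightarrow> (real \<Rightarrow> 'a) \<Rightarrow> bool" where
  "ae_eq v w \<longleftrightarrow> (AE x in lebesgue. v x = w x)"

definition fun_subspace :: "(real \<Rightarrow> 'a::real_vector) set \<Rightarrow> bool" where
  "fun_subspace X \<longleftrightarrow> (\<lambda>x. 0) \<in> X
     \<and> (\<forall>v\<in>X. \<forall>w\<in>X. (\<lambda>x. v x + w x) \<in> X)
     \<and> (\<forall>c. \<forall>v\<in>X. (\<lambda>x. c *\<^sub>R v x) \<in> X)"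

text \<open>
  \<open>N w = 0\<close> only forces \<open>w\<close> to vanish almost everywhere. This covers spaces of genuine
  functions (where \<open>N w = 0\<close> only for \<open>w = 0\<close>) as well as spaces of equivalence classes.
\<close>

definition banach_function_space ::
    "(real \<Rightarrow> 'a::real_normed_vector) set \<Rightarrow> ((real \<Rightarrow> 'a) \<Rightarrow> real) \<Rightarrow> bool" where
  "banach_function_space X N \<longleftrightarrow> fun_subspace X
     \<and> (\<forall>v\<in>X. 0 \<le> N v)
     \<and> N (\<lambda>x. 0) = 0
     \<and> (\<forall>v\<in>X. N v = 0 \<longrightarrow> ae_eq v (\<lambda>x. 0))
     \<and> (\<forall>c. \<forall>v\<in>X. N (\<lambda>x. c *\<^sub>R v x) = \<bar>c\<bar> * N v)
     \<and> (\<forall>v\<in>X. \<forall>w\<in>X. N (\<lambda>x. v x + w x) \<le> N v + N w)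
     \<and> (\<forall>s. (\<forall>n. s n \<in> X)
            \<and> (\<forall>e>0. \<exists>M. \<forall>m\<ge>M. \<forall>n\<ge>M. N (\<lambda>x. s m x - s n x) < e)
          \<longrightarrow> (\<exists>v\<in>X. (\<lambda>n. N (\<lambda>x. s n x - v x)) \<longlonglongrightarrow> 0))"

definition L1_loc :: "(real \<Rightarrow> 'a::euclidean_space) set" where
  "L1_loc = {w. \<forall>a b. w absolutely_integrable_on {a..b}}"

text \<open>
  The locally convex topology given by the seminorms \<open>w \<mapsto> \<integral>\<^sub>a\<^sup>b |w|\<close>. It is not
  Hausdorff on functions, but its open sets are saturated for equality almost everywhere, so
  compactness means compactness of the set of equivalence classes.
\<close>

definition L1_loc_topology :: "(real \<Rightarrow> 'a::euclidean_space) topology" where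
  "L1_loc_topology = topology_generated_by
     {{w \<in> L1_loc. integral {a..b} (\<lambda>x. norm (w x - v x)) < e} | a b v e. v \<in> L1_loc \<and> 0 < e}"

definition is_solution ::
    "(real^'d \<Rightarrow> real^'d) \<Rightarrow> (real \<Rightarrow> real^'d) set \<Rightarrow> ((real \<Rightarrow> real^'d) \<Rightarrow> real)
      \<Rightarrow> (real \<Rightarrow> real^'d) set \<Rightarrow> ((real \<Rightarrow> real^'d) \<Rightarrow> real)
      \<Rightarrow> real \<Rightarrow> (real \<Rightarrow> real \<Rightarrow> real^'d) \<Rightarrow> bool" where
  \<comment> \<open>\<open>u t x\<close> is the value at time \<open>t \<in> [0,\<tau>]\<close> and position \<open>x\<close>\<close>
  "is_solution f Ub Nb Uc Nc \<tau> u \<longleftrightarrow>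
     (\<forall>t\<in>{0..\<tau>}. u t \<in> Uc)
   \<and> (\<forall>t\<in>{0..\<tau>}. ((\<lambda>s. Nc (\<lambda>x. u s x - u t x)) \<longlongrightarrow> 0) (at t within {0..\<tau>}))
   \<and> (\<forall>t\<in>{0..\<tau>}. u t \<in> Ub)
   \<and> (\<exists>B. \<forall>t\<in>{0..\<tau>}. Nb (u t) \<le> B)
   \<and> (\<forall>t1 t2. 0 \<le> t1 \<and> t1 \<le> t2 \<and> t2 \<le> \<tau> \<longrightarrow>
        (\<forall>x. (\<lambda>t. f (u t x)) absolutely_integrable_on {t1..t2})
      \<and> continuous_on UNIV (\<lambda>x. integral {t1..t2} (\<lambda>t. f (u t x))))
   \<and> (\<forall>x1 x2. x1 \<le> x2 \<longrightarrow>
        (\<forall>t\<in>{0..\<tau>}. u t absolutely_integrable_on {x1..x2})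
      \<and> continuous_on {0..\<tau>} (\<lambda>t. integral {x1..x2} (u t)))
   \<and> (\<forall>x1 x2 t1 t2. x1 \<le> x2 \<and> 0 \<le> t1 \<and> t1 \<le> t2 \<and> t2 \<le> \<tau> \<longrightarrow>
        integral {x1..x2} (u t2) - integral {x1..x2} (u t1)
        = - (integral {t1..t2} (\<lambda>t. f (u t x2)) - integral {t1..t2} (\<lambda>t. f (u t x1))))"

text \<open>
  The predicate \<open>E\<close> stands for additional constraints (such as entropy conditions) on functions on
  the time interval \<open>[0,\<tau>]\<close>; it may be constantly true. \<open>S t \<xi> x\<close> is \<open>u(x,t;\<xi>)\<close>.
\<close>

definition is_unique_solution ::
    "(real^'d \<Rightarrow> real^'d) \<Rightarrow> (real \<Rightarrow> real^'d) set \<Rightarrow> ((real \<Rightarrow> real^'d) \<Rightarrow> real)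
      \<Rightarrow> (real \<Rightarrow> real^'d) set \<Rightarrow> ((real \<Rightarrow> real^'d) \<Rightarrow> real)
      \<Rightarrow> (real \<Rightarrow> (real \<Rightarrow> real \<Rightarrow> real^'d) \<Rightarrow> bool)
      \<Rightarrow> real \<Rightarrow> (real \<Rightarrow> real^'d) \<Rightarrow> (real \<Rightarrow> real \<Rightarrow> real^'d) \<Rightarrow> bool" where
  "is_unique_solution f Ub Nb Uc Nc E \<tau> \<xi> u \<longleftrightarrow>
     is_solution f Ub Nb Uc Nc \<tau> u \<and> ae_eq (u 0) \<xi> \<and> E \<tau> u
   \<and> (\<forall>v. is_solution f Ub Nb Uc Nc \<tau> v \<and> ae_eq (v 0) \<xi> \<and> E \<tau> v
        \<longrightarrow> (\<forall>t\<in>{0..\<tau>}. ae_eq (v t) (u t)))"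

text \<open>\<open>edge h j\<close> is \<open>x\<^bsub>j+1/2\<^esub>\<close>, so \<open>x\<^bsub>j-1/2\<^esub>\<close> is \<open>edge h (j - 1)\<close>.\<close>

definition edge :: "real \<Rightarrow> int \<Rightarrow> real" where
  "edge h j = of_int j * h + h / 2"

definition cell :: "real \<Rightarrow> int \<Rightarrow> real set" where
  "cell h j = {edge h (j - 1) <..< edge h j}"

definition cell_average :: "real \<Rightarrow> (real \<Rightarrow> real^'d) \<Rightarrow> int \<Rightarrow> real^'d" where
  "cell_average h w j = (1 / h) *\<^sub>R integral (cell h j) w"

text \<open>
  The time steps \<open>k\<close> and mesh ratios \<open>lam = k / h\<close> for which the scheme is considered. All the
  discrete objects (\<open>V\<close>, \<open>P\<close>, \<open>F\<close>, ...) carry both parameters, since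
  the grid size \<open>h = k / lam\<close> depends on both.
\<close>

definition valid_mesh :: "real \<Rightarrow> real \<Rightarrow> real \<Rightarrow> real \<Rightarrow> bool" where
  "valid_mesh T lam0 lam k \<longleftrightarrow> 0 < lam \<and> lam < lam0 \<and> 0 < k \<and> k < T / 2"

text \<open>A set of functions on \<open>I\<^sub>j\<close> closed under linear combinations is finite dimensional iff it
  lies in the span of a finite set.\<close>

definition grid_space :: "(real \<Rightarrow> real^'d) set \<Rightarrow> real \<Rightarrow> (real \<Rightarrow> real^'d) set \<Rightarrow> bool" where
  "grid_space U h V \<longleftrightarrow> V \<subseteq> U \<and> fun_subspace V
     \<and> (\<forall>j. \<exists>B. finite B \<and>
          (\<forall>v\<in>V. \<exists>c. AE x in lebesgue. x \<in> cell h j \<longrightarrow> v x = (\<Sum>b\<in>B. c b *\<^sub>R b x)))"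

text \<open>Linearity of the projection is not required.\<close>

definition conservative_projection ::
    "(real \<Rightarrow> real^'d) set \<Rightarrow> real \<Rightarrow> (real \<Rightarrow> real^'d) set
      \<Rightarrow> ((real \<Rightarrow> real^'d) \<Rightarrow> real \<Rightarrow> real^'d) \<Rightarrow> bool" where
  "conservative_projection U h V P \<longleftrightarrow>
     (\<forall>v\<in>U. P v \<in> V)
   \<and> (\<forall>v\<in>V. ae_eq (P v) v)
   \<and> (\<forall>v\<in>U. \<forall>j. v absolutely_integrable_on cell h j
        \<and> P v absolutely_integrable_on cell h j
        \<and> integral (cell h j) (P v) = integral (cell h j) v)"

text \<open>
  \<open>F lam k \<xi> j t\<close> is the numerical flux at \<open>x\<^bsub>j+1/2\<^esub>\<close> and time \<open>t\<close>. Continuity on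
  the half-open interval does not give integrability over it, which the use of
  \<open>\<integral>\<^sub>0\<^sup>k F dt\<close> presupposes.
\<close>

definition approximate_fluxes ::
    "(real^'d \<Rightarrow> real^'d) \<Rightarrow> real \<Rightarrow> real \<Rightarrow> (real \<Rightarrow> real \<Rightarrow> (real \<Rightarrow> real^'d) set)
      \<Rightarrow> (real \<Rightarrow> real \<Rightarrow> (real \<Rightarrow> real^'d) \<Rightarrow> int \<Rightarrow> real \<Rightarrow> real^'d) \<Rightarrow> bool" where
  "approximate_fluxes f T lam0 V F \<longleftrightarrow>
     (\<forall>lam k. valid_mesh T lam0 lam k \<longrightarrow> (\<forall>\<xi>\<in>V lam k. \<forall>j.
        continuous_on {0..<k} (F lam k \<xi> j)
      \<and> F lam k \<xi> j absolutely_integrable_on {0..<k}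
      \<and> (\<forall>\<eta>\<in>V lam k. (\<forall>x \<in> cell (k / lam) j \<union> cell (k / lam) (j + 1). \<eta> x = \<xi> x)
            \<longrightarrow> (\<forall>t\<in>{0..<k}. F lam k \<eta> j t = F lam k \<xi> j t))
      \<and> (\<forall>c. (\<forall>x \<in> cell (k / lam) j \<union> cell (k / lam) (j + 1). \<xi> x = c)
            \<longrightarrow> (\<forall>t\<in>{0..<k}. F lam k \<xi> j t = f c))))"

definition admissible ::
    "((real \<Rightarrow> real^'d) \<Rightarrow> real) \<Rightarrow> real \<Rightarrow> real \<Rightarrow> (real \<Rightarrow> real \<Rightarrow> (real \<Rightarrow> real^'d) set)
      \<Rightarrow> (real \<Rightarrow> real^'d) set \<Rightarrow> bool" where
  "admissible N T lam0 V H \<longleftrightarrow>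
     H \<subseteq> (\<Union>{V lam k | lam k. valid_mesh T lam0 lam k})
   \<and> (\<forall>lam k. valid_mesh T lam0 lam k \<longrightarrow>
        (\<exists>M. \<forall>\<xi> \<in> H \<inter> V lam k. N \<xi> \<le> M)
      \<and> compactin L1_loc_topology (H \<inter> V lam k))"

definition consistent_fluxes ::
    "(real^'d \<Rightarrow> real^'d) \<Rightarrow> ((real \<Rightarrow> real^'d) \<Rightarrow> real) \<Rightarrow> real \<Rightarrow> real
      \<Rightarrow> (real \<Rightarrow> real \<Rightarrow> (real \<Rightarrow> real^'d) set)
      \<Rightarrow> (real \<Rightarrow> (real \<Rightarrow> real^'d) \<Rightarrow> real \<Rightarrow> real^'d)
      \<Rightarrow> (real \<Rightarrow> real \<Rightarrow> (real \<Rightarrow> real^'d) \<Rightarrow> int \<Rightarrow> real \<Rightarrow> real^'d) \<Rightarrow> real \<Rightarrow> bool" where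
  "consistent_fluxes f N T lam0 V S F q \<longleftrightarrow>
     (\<forall>H. admissible N T lam0 V H \<longrightarrow>
       (\<exists>C>0. \<forall>lam k. valid_mesh T lam0 lam k \<longrightarrow> (\<forall>\<xi> \<in> H \<inter> V lam k. \<forall>j.
          norm (integral {0..<k} (\<lambda>t. F lam k \<xi> j t - F lam k \<xi> (j - 1) t)
                - integral {0..k} (\<lambda>t. f (S t \<xi> (edge (k / lam) j))
                                       - f (S t \<xi> (edge (k / lam) (j - 1)))))
          \<le> C * k powr (2 + q))))"

definition approximate_evolution ::
    "(real \<Rightarrow> real^'d) set \<Rightarrow> real \<Rightarrow> real \<Rightarrow> (real \<Rightarrow> real \<Rightarrow> (real \<Rightarrow> real^'d) set)
      \<Rightarrow> (real \<Rightarrow> real \<Rightarrow> (real \<Rightarrow> real^'d) \<Rightarrow> int \<Rightarrow> real \<Rightarrow> real^'d)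
      \<Rightarrow> (real \<Rightarrow> real \<Rightarrow> (real \<Rightarrow> real^'d) \<Rightarrow> real \<Rightarrow> real^'d) \<Rightarrow> bool" where
  "approximate_evolution U T lam0 V F A \<longleftrightarrow>
     (\<forall>lam k. valid_mesh T lam0 lam k \<longrightarrow> (\<forall>\<xi>\<in>V lam k. A lam k \<xi> \<in> U \<and> (\<forall>j.
        integral (cell (k / lam) j) (A lam k \<xi>) - integral (cell (k / lam) j) \<xi>
        = - integral {0..<k} (\<lambda>t. F lam k \<xi> j t - F lam k \<xi> (j - 1) t))))"

definition finite_volume_scheme ::
    "(real \<Rightarrow> real^'d) set \<Rightarrow> real \<Rightarrow> real \<Rightarrow> (real \<Rightarrow> real \<Rightarrow> (real \<Rightarrow> real^'d) set)
      \<Rightarrow> (real \<Rightarrow> real \<Rightarrow> (real \<Rightarrow> real^'d) \<Rightarrow> real \<Rightarrow> real^'d)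
      \<Rightarrow> (real \<Rightarrow> real \<Rightarrow> (real \<Rightarrow> real^'d) \<Rightarrow> int \<Rightarrow> real \<Rightarrow> real^'d)
      \<Rightarrow> (real \<Rightarrow> real \<Rightarrow> (real \<Rightarrow> real^'d) \<Rightarrow> real \<Rightarrow> real^'d) \<Rightarrow> bool" where
  "finite_volume_scheme U T lam0 V P F \<Phi> \<longleftrightarrow>
     (\<exists>A. approximate_evolution U T lam0 V F A
        \<and> (\<forall>lam k. valid_mesh T lam0 lam k \<longrightarrow> (\<forall>\<xi>\<in>V lam k. \<Phi> lam k \<xi> = P lam k (A lam k \<xi>))))"

definition discrete_operator ::
    "real \<Rightarrow> ((real \<Rightarrow> real^'d) \<Rightarrow> real \<Rightarrow> real^'d) \<Rightarrow> (real \<Rightarrow> real^'d) \<Rightarrow> int \<Rightarrow> real^'d" where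
  "discrete_operator h \<Phi> \<xi> j = cell_average h (\<Phi> \<xi>) j - cell_average h \<xi> j"

end

theory Submission
  imports Defs
begin

text \<open>
  Both \<open>P\<close> and the balance law preserve cell integrals, so the truncation error of the averages is
  \<open>1 / h\<close> times the difference of the numerical and the exact flux balance over the cell. The
  latter is \<open>O(k powr (2 + q))\<close>, and \<open>1 / h = lam / k\<close> with \<open>lam < lam0\<close> costs one power of \<open>k\<close>.
\<close>

text \<open>A solution attains its initial data only almost everywhere; this lets \<open>u 0\<close>
  be replaced by \<open>\<xi>\<close> under cell integrals.\<close>

lemma integral_cong_ae_eq:
  fixes v w :: "real \<Rightarrow> 'a::banach"
  assumes "ae_eq v w"
  shows "integral A v = integral A w"
proof -
  obtain N where "{x \<in> space lebesgue. v x \<noteq> w x} \<subseteq> N" "N \<in> null_sets lebesgue"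
    using assms unfolding ae_eq_def eventually_ae_filter by auto
  then show ?thesis
    by (intro integral_spike[of N]) (force simp: negligible_iff_null_sets)+
qed

lemma edge_le: "0 \<le> h \<Longrightarrow> edge h (j - 1) \<le> edge h j"
  by (simp add: edge_def algebra_simps)

text \<open>The balance law applied to the closure of one cell over the whole step,
  \<open>t1 = 0\<close> and \<open>t2 = \<tau>\<close>. The two edge fluxes are merged under one
  integral to match the form used in \<open>consistent_fluxes\<close>.\<close>

lemma cell_integral_balance:
  assumes "is_solution f Ub Nb Uc Nc \<tau> u" and "0 \<le> \<tau>" and "0 \<le> h"
  shows "integral (cell h j) (u \<tau>) - integral (cell h j) (u 0)
    = - integral {0..\<tau>} (\<lambda>t. f (u t (edge h j)) - f (u t (edge h (j - 1))))"
proof -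
  \<comment> \<open>Merging the edge integrals needs integrability of each, since
    \<open>integral\<close> is 0 by default on non-integrable functions.\<close>
  have "(\<lambda>t. f (u t x)) integrable_on {0..\<tau>}" for x
    using assms unfolding is_solution_def
    by (auto intro: set_lebesgue_integral_eq_integral(1))
  then have "integral {0..\<tau>} (\<lambda>t. f (u t (edge h j)) - f (u t (edge h (j - 1))))
      = integral {0..\<tau>} (\<lambda>t. f (u t (edge h j))) - integral {0..\<tau>} (\<lambda>t. f (u t (edge h (j - 1))))"
    by (intro integral_diff)
  moreover have "integral {edge h (j - 1)..edge h j} (u \<tau>) - integral {edge h (j - 1)..edge h j} (u 0)
      = - (integral {0..\<tau>} (\<lambda>t. f (u t (edge h j))) - integral {0..\<tau>} (\<lambda>t. f (u t (edge h (j - 1)))))"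
    using assms edge_le[of h j] unfolding is_solution_def by auto
  \<comment> \<open>Cells are open while the balance law uses closed intervals; the endpoints do not
    affect the integral.\<close>
  ultimately show ?thesis
    by (simp add: cell_def integral_open_interval_real)
qed

lemma cell_average_projection:
  assumes "conservative_projection U h V P" and "v \<in> U"
  shows "cell_average h (P v) j = cell_average h v j"
  using assms by (simp add: conservative_projection_def cell_average_def)

text \<open>The exact and the approximate evolution both start from \<open>\<xi>\<close>, so their
  cell integrals after one step differ exactly by their flux balances. The factor
  \<open>lam / k\<close> is \<open>1 / h\<close>.\<close>

lemma truncation_error_eq_flux_defect:
  assumes sol: "is_solution f Ub Nb Uc Nc k u" and init: "ae_eq (u 0) \<xi>"
    and proj: "conservative_projection (Ub \<inter> Uc) (k / lam) (V lam k) (P lam k)"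
    and fvs: "finite_volume_scheme (Ub \<inter> Uc) T lam0 V P F \<Phi>"
    and mesh: "valid_mesh T lam0 lam k" and "\<xi> \<in> V lam k"
  shows "cell_average (k / lam) (P lam k (u k)) j
        - (cell_average (k / lam) \<xi> j + discrete_operator (k / lam) (\<Phi> lam k) \<xi> j)
    = (lam / k) *\<^sub>R
        (integral {0..<k} (\<lambda>t. F lam k \<xi> j t - F lam k \<xi> (j - 1) t)
         - integral {0..k} (\<lambda>t. f (u t (edge (k / lam) j)) - f (u t (edge (k / lam) (j - 1)))))"
proof -
  have k: "0 < k" "0 < lam"
    using mesh by (auto simp: valid_mesh_def)
  \<comment> \<open>\<open>P\<close> conserves cell integrals of elements of
    \<open>Ub \<inter> Uc\<close>, hence this membership and the one for
    \<open>A lam k \<xi>\<close> below.\<close>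
  have "u k \<in> Ub \<inter> Uc"
    using sol k by (auto simp: is_solution_def)
  then have exact: "cell_average (k / lam) (P lam k (u k)) j = cell_average (k / lam) (u k) j"
    by (rule cell_average_projection[OF proj])
  obtain A where A: "approximate_evolution (Ub \<inter> Uc) T lam0 V F A"
    and "\<Phi> lam k \<xi> = P lam k (A lam k \<xi>)"
    using fvs mesh \<open>\<xi> \<in> V lam k\<close> unfolding finite_volume_scheme_def by blast
  moreover have "A lam k \<xi> \<in> Ub \<inter> Uc"
    and num: "integral (cell (k / lam) j) (A lam k \<xi>) - integral (cell (k / lam) j) \<xi>
        = - integral {0..<k} (\<lambda>t. F lam k \<xi> j t - F lam k \<xi> (j - 1) t)"
    using A mesh \<open>\<xi> \<in> V lam k\<close> unfolding approximate_evolution_def by blast+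
  ultimately have scheme: "cell_average (k / lam) (\<Phi> lam k \<xi>) j = cell_average (k / lam) (A lam k \<xi>) j"
    by (simp add: cell_average_projection[OF proj])
  have bal: "integral (cell (k / lam) j) (u k) - integral (cell (k / lam) j) \<xi>
      = - integral {0..k} (\<lambda>t. f (u t (edge (k / lam) j)) - f (u t (edge (k / lam) (j - 1))))"
    using cell_integral_balance[OF sol, of "k / lam" j] integral_cong_ae_eq[OF init] k by simp
  have "integral (cell (k / lam) j) (u k) - integral (cell (k / lam) j) (A lam k \<xi>)
      = integral {0..<k} (\<lambda>t. F lam k \<xi> j t - F lam k \<xi> (j - 1) t)
         - integral {0..k} (\<lambda>t. f (u t (edge (k / lam) j)) - f (u t (edge (k / lam) (j - 1))))"
    using num bal by (simp add: algebra_simps)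
  \<comment> \<open>The average of \<open>\<xi>\<close> cancels against the one subtracted in
    \<open>discrete_operator\<close>.\<close>
  moreover have "cell_average (k / lam) (P lam k (u k)) j
        - (cell_average (k / lam) \<xi> j + discrete_operator (k / lam) (\<Phi> lam k) \<xi> j)
      = (lam / k) *\<^sub>R (integral (cell (k / lam) j) (u k) - integral (cell (k / lam) j) (A lam k \<xi>))"
    unfolding discrete_operator_def exact scheme
    by (simp add: cell_average_def scaleR_diff_right)
  ultimately show ?thesis
    by simp
qed

text \<open>The constant is chosen after \<open>H\<close> but before the mesh, the initial data,
  \<open>n\<close> and \<open>j\<close>, which expresses the uniformity of the bound. It is claimed
  at those \<open>n\<close> with \<open>\<theta> n \<in> H\<close>, where flux consistency supplies
  an estimate.\<close>

theorem corollary3p20: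
  fixes f :: "real^'d \<Rightarrow> real^'d"
    and T lam0 q :: real
    and Ub Uc :: "(real \<Rightarrow> real^'d) set"
    and Nb Nc :: "(real \<Rightarrow> real^'d) \<Rightarrow> real"
    and V :: "real \<Rightarrow> real \<Rightarrow> (real \<Rightarrow> real^'d) set"
    and P :: "real \<Rightarrow> real \<Rightarrow> (real \<Rightarrow> real^'d) \<Rightarrow> real \<Rightarrow> real^'d"
    and E :: "real \<Rightarrow> (real \<Rightarrow> real \<Rightarrow> real^'d) \<Rightarrow> bool"
    and S :: "real \<Rightarrow> (real \<Rightarrow> real^'d) \<Rightarrow> real \<Rightarrow> real^'d"
    and F :: "real \<Rightarrow> real \<Rightarrow> (real \<Rightarrow> real^'d) \<Rightarrow> int \<Rightarrow> real \<Rightarrow> real^'d"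
    and \<Phi> :: "real \<Rightarrow> real \<Rightarrow> (real \<Rightarrow> real^'d) \<Rightarrow> real \<Rightarrow> real^'d"
  assumes "T > 0" and "lam0 > 0" and "q \<ge> 0"
    and "banach_function_space Ub Nb" and "banach_function_space Uc Nc"
    and "\<And>lam k. valid_mesh T lam0 lam k \<Longrightarrow> grid_space (Ub \<inter> Uc) (k / lam) (V lam k)"
    and "\<And>lam k. valid_mesh T lam0 lam k \<Longrightarrow>
           conservative_projection (Ub \<inter> Uc) (k / lam) (V lam k) (P lam k)"
    and "\<And>lam k \<xi>. valid_mesh T lam0 lam k \<Longrightarrow> \<xi> \<in> V lam k \<Longrightarrow>
           is_unique_solution f Ub Nb Uc Nc E k \<xi> (\<lambda>t. S t \<xi>)"
    and "approximate_fluxes f T lam0 V F"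
    and "consistent_fluxes f (\<lambda>w. Nb w + Nc w) T lam0 V S F q"
    and "finite_volume_scheme (Ub \<inter> Uc) T lam0 V P F \<Phi>"
  shows "\<forall>H. admissible (\<lambda>w. Nb w + Nc w) T lam0 V H \<longrightarrow>
    (\<exists>C>0. \<forall>lam k u0 \<theta>.
       valid_mesh T lam0 lam k \<and> u0 \<in> Ub \<inter> Uc
       \<and> \<theta> 0 = P lam k u0 \<and> (\<forall>n. \<theta> (Suc n) = P lam k (S k (\<theta> n)))
       \<longrightarrow> (\<forall>n. \<theta> n \<in> H \<longrightarrow> (\<forall>j.
              norm (cell_average (k / lam) (\<theta> (Suc n)) j
                    - (cell_average (k / lam) (\<theta> n) j
                       + discrete_operator (k / lam) (\<Phi> lam k) (\<theta> n) j))
              \<le> C * k powr (1 + q))))"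
proof (intro allI impI)
  fix H
  assume "admissible (\<lambda>w. Nb w + Nc w) T lam0 V H"
  then obtain C where "C > 0" and C: "\<And>lam k \<xi> j. valid_mesh T lam0 lam k \<Longrightarrow> \<xi> \<in> H \<inter> V lam k \<Longrightarrow>
      norm (integral {0..<k} (\<lambda>t. F lam k \<xi> j t - F lam k \<xi> (j - 1) t)
            - integral {0..k} (\<lambda>t. f (S t \<xi> (edge (k / lam) j)) - f (S t \<xi> (edge (k / lam) (j - 1)))))
        \<le> C * k powr (2 + q)"
    using assms(10) unfolding consistent_fluxes_def by meson
  show "\<exists>C>0. \<forall>lam k u0 \<theta>.
       valid_mesh T lam0 lam k \<and> u0 \<in> Ub \<inter> Uc
       \<and> \<theta> 0 = P lam k u0 \<and> (\<forall>n. \<theta> (Suc n) = P lam k (S k (\<theta> n)))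
       \<longrightarrow> (\<forall>n. \<theta> n \<in> H \<longrightarrow> (\<forall>j.
              norm (cell_average (k / lam) (\<theta> (Suc n)) j
                    - (cell_average (k / lam) (\<theta> n) j
                       + discrete_operator (k / lam) (\<Phi> lam k) (\<theta> n) j))
              \<le> C * k powr (1 + q)))"
  proof (intro exI conjI allI impI; (elim conjE)?)
    \<comment> \<open>This fixes the witness: \<open>C\<close> comes from flux consistency, and
      \<open>lam0\<close> bounds the \<open>lam\<close> left over from
      \<open>1 / h = lam / k\<close>, so the constant is independent of the mesh.\<close>
    show "0 < lam0 * C"
      using \<open>lam0 > 0\<close> \<open>C > 0\<close> by simp
  next
    fix lam k u0 \<theta> n j
    assume mesh: "valid_mesh T lam0 lam k" and "u0 \<in> Ub \<inter> Uc" and "\<theta> 0 = P lam k u0"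
      and step: "\<forall>n. \<theta> (Suc n) = P lam k (S k (\<theta> n))" and "\<theta> n \<in> H"
    have k: "0 < k" "0 < lam" "lam < lam0"
      using mesh by (auto simp: valid_mesh_def)
    note proj = assms(7)[OF mesh]
    have sol: "is_solution f Ub Nb Uc Nc k (\<lambda>t. S t \<xi>)" "ae_eq (S 0 \<xi>) \<xi>" if "\<xi> \<in> V lam k" for \<xi>
      using assms(8)[OF mesh that] by (auto simp: is_unique_solution_def)
    \<comment> \<open>\<open>H\<close> may contain functions from the spaces of many meshes, so
      \<open>\<theta> n \<in> H\<close> does not place \<open>\<theta> n\<close> in the space of
      this mesh; induction along the recursion does.\<close>
    have "\<theta> m \<in> V lam k" for m
    proof (induction m)
      case 0
      then show ?case
        using proj \<open>u0 \<in> Ub \<inter> Uc\<close> \<open>\<theta> 0 = P lam k u0\<close> by (simp add: conservative_projection_def)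
    next
      case (Suc m)
      then have "S k (\<theta> m) \<in> Ub \<inter> Uc"
        using sol(1)[OF Suc] k by (auto simp: is_solution_def)
      then show ?case
        using proj step by (simp add: conservative_projection_def)
    qed
    then have V: "\<theta> n \<in> V lam k" .
    have "norm (cell_average (k / lam) (\<theta> (Suc n)) j
        - (cell_average (k / lam) (\<theta> n) j + discrete_operator (k / lam) (\<Phi> lam k) (\<theta> n) j))
      \<le> (lam / k) * (C * k powr (2 + q))"
      using C[OF mesh, of "\<theta> n" j] V \<open>\<theta> n \<in> H\<close> k
      by (simp add: step truncation_error_eq_flux_defect[OF sol[OF V] proj assms(11) mesh V]
          divide_right_mono mult_left_mono)
    \<comment> \<open>Splitting \<open>k powr (2 + q)\<close> as \<open>k * k powr (1 + q)\<close>
      cancels the \<open>k\<close> in the denominator.\<close>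
    also have "\<dots> = lam * C * k powr (1 + q)"
      using k powr_mult_base[of k "1 + q"] by (simp add: field_simps)
    also have "\<dots> \<le> lam0 * C * k powr (1 + q)"
      using k \<open>C > 0\<close> by (intro mult_right_mono) auto
    finally show "norm (cell_average (k / lam) (\<theta> (Suc n)) j
        - (cell_average (k / lam) (\<theta> n) j + discrete_operator (k / lam) (\<Phi> lam k) (\<theta> n) j))
      \<le> lam0 * C * k powr (1 + q)" .
  qed
qed

end
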